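(* Let $q=s=1/2$. There exists a family of positive-integer-valued, almost surely finite base times $(T_0^{(\varepsilon)})$, indexed by $\varepsilon\to0$, such that, writing $g_\varepsilon$ for the probability generating function of $T_0^{(\varepsilon)}$, $T_\varepsilon$ for the completion time under memoryless catastrophe with rate $q$, $W_\varepsilon=T_\varepsilon/E[T_\varepsilon]$, $p_\varepsilon=g_\varepsilon(s)$ and $\alpha_\varepsilon=\dfrac{s(p_\varepsilon-q\,g_\varepsilon'(s))}{1-p_\varepsilon}$, one has \[ |\alpha_\varepsilon|=o(p_\varepsilon)\qquad\text{but}\qquad d_{\mathrm K}(W_\varepsilon,\mathrm{Exp}(1))=\Theta(p_\varepsilon)\qquad(\varepsilon\to0). \]
   Context: The probability generating function of $T_0$ is $g(z)=E[z^{T_0}]$. $\mathrm{Exp}(1)$ is the exponential distribution with mean $1$; $d_{\mathrm K}(X,Y)=\sup_x|P(X\le x)-P(Y\le x)|$. Memoryless catastrophe with rate $q$, $s=1-q$: attempts $i=1,2,\dots$ are independent; attempt $i$ has a copy $T_0^{(i)}$ of the base time $T_0$ and an independent $\tau_i$ with $P(\tau_i>t)=s^t$, $t=0,1,2,\dots$ (catastrophe occurs at each step independently with probability $q$); it succeeds iff $T_0^{(i)}<\tau_i$, and lasts $\min(T_0^{(i)},\tau_i)$ steps. The completion time $T$ is the total length of all attempts up to and including the first successful one. The success probability of an attempt is $p=g(s)$, and $E[T]=(1-p)/(qp)$. *)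

theory Defs
  imports "HOL-Probability.Probability" "HOL-Library.Landau_Symbols"
begin

text \<open>The law of a positive-integer-valued, almost surely finite base time is a
  \<^typ>\<open>nat pmf\<close> supported in \<^term>\<open>{1::nat..}\<close>.\<close>

definition pgf :: "nat pmf \<Rightarrow> real \<Rightarrow> real" where
  "pgf D z = measure_pmf.expectation D (\<lambda>n. z ^ n)"

text \<open>\<^const>\<open>geometric_pmf\<close> counts failures before the first success and starts at \<open>0\<close>;
  the shift gives \<open>P(\<tau> > t) = (1 - q) ^ t\<close> for \<open>t = 0, 1, \<dots>\<close>.\<close>

definition catastrophe_time_pmf :: "real \<Rightarrow> nat pmf" where
  "catastrophe_time_pmf q = map_pmf Suc (geometric_pmf q)"

text \<open>A point of the sample space is the sequence of pairs (base time, catastrophe time)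
  of the attempts. The attempts are numbered from \<open>0\<close>.\<close>

definition attempts :: "real \<Rightarrow> nat pmf \<Rightarrow> (nat \<Rightarrow> nat \<times> nat) measure" where
  "attempts q D =
     PiM UNIV (\<lambda>_. measure_pmf (pair_pmf D (catastrophe_time_pmf q)))"

definition succeeds :: "nat \<times> nat \<Rightarrow> bool" where
  "succeeds a \<longleftrightarrow> fst a < snd a"

definition duration :: "nat \<times> nat \<Rightarrow> nat" where
  "duration a = min (fst a) (snd a)"

text \<open>The value \<open>0\<close> when no attempt succeeds is a convention on a null event, since a finite
  base time gives every attempt the same positive success probability for \<open>q < 1\<close>.\<close>

definition completion_time :: "(nat \<Rightarrow> nat \<times> nat) \<Rightarrow> nat" where
  "completion_time \<omega> =
     (if \<exists>i. succeeds (\<omega> i)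
      then \<Sum>i\<le>(LEAST i. succeeds (\<omega> i)). duration (\<omega> i)
      else 0)"

definition mean_completion_time :: "real \<Rightarrow> nat pmf \<Rightarrow> real" where
  "mean_completion_time q D = (\<integral>\<omega>. real (completion_time \<omega>) \<partial>attempts q D)"

definition normalized_completion_law :: "real \<Rightarrow> nat pmf \<Rightarrow> real measure" where
  "normalized_completion_law q D =
     distr (attempts q D) borel
       (\<lambda>\<omega>. real (completion_time \<omega>) / mean_completion_time q D)"

definition exp1_law :: "real measure" where
  "exp1_law = density lborel (exponential_density 1)"

definition kolmogorov_dist :: "real measure \<Rightarrow> real measure \<Rightarrow> real" where
  "kolmogorov_dist M N = (SUP x. \<bar>cdf M x - cdf N x\<bar>)"

definition alpha :: "real \<Rightarrow> real \<Rightarrow> nat pmf \<Rightarrow> real" where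
  "alpha q s D = s * (pgf D s - q * deriv (pgf D) s) / (1 - pgf D s)"

end

theory Submission imports Defs begin

text \<open>
  Write \<open>s = 1 - q\<close>, \<open>c\<^sub>k = P(T\<^sub>0 = k) s\<^sup>k\<close>, \<open>p = \<Sum> c\<^sub>k = g(s)\<close> and \<open>R = \<Sum> k c\<^sub>k = s g'(s)\<close>.
  Conditioning on the first attempt gives a renewal equation for the tail \<open>a\<^sub>n = P(T > n)\<close>, which
  telescopes to \<open>a\<^sub>n\<^sub>+\<^sub>1 = a\<^sub>n - q \<Sum>\<^sub>k\<^sub>\<le>\<^sub>n c\<^sub>k a\<^sub>n\<^sub>-\<^sub>k - c\<^sub>n\<^sub>+\<^sub>1\<close>. Summing it gives the mean \<open>(1 - p) / (q p)\<close>;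
  since each step lowers the tail by at most \<open>p\<close>, replacing \<open>a\<^sub>n\<^sub>-\<^sub>k\<close> by \<open>a\<^sub>n\<close> makes it a
  perturbed geometric recursion, so the Kolmogorov distance to the exponential law is \<open>O(p + R)\<close> for every base time.

  For \<open>q = 1/2\<close> the base time is \<open>1\<close> with probability \<open>\<epsilon>\<close> and otherwise a number \<open>N\<close> so large that
  \<open>N 2\<^sup>-\<^sup>N \<le> \<epsilon>\<^sup>2\<close>. Then \<open>p\<close> and \<open>R\<close> both are \<open>\<epsilon>/2 + O(\<epsilon>\<^sup>2)\<close>, so \<open>\<alpha>\<close>, which is proportional to
  \<open>p - R\<close>, is \<open>O(\<epsilon>\<^sup>2)\<close>. With \<open>\<mu> = 1/E[T]\<close>, the mass \<open>c\<^sub>1 = \<epsilon>/2\<close> of \<open>T/E[T]\<close> at \<open>\<mu>\<close> is about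
  twice the mass \<open>1 - e\<^sup>-\<^sup>\<mu> \<approx> \<epsilon>/4\<close> that the exponential law has up to \<open>\<mu>\<close>, whence the lower bound.
\<close>

section \<open>Measurability, and splitting off the first attempt\<close>

lemma measurable_attempt [measurable]:
  "(\<lambda>\<omega>. \<omega> i) \<in> attempts q D \<rightarrow>\<^sub>M count_space UNIV"
proof -
  have "(\<lambda>\<omega>. \<omega> i) \<in> attempts q D \<rightarrow>\<^sub>M measure_pmf (pair_pmf D (catastrophe_time_pmf q))"
    unfolding attempts_def by measurable
  then show ?thesis
    by (simp cong: measurable_cong_sets)
qed

lemma space_attempts [simp]: "space (attempts q D) = UNIV"
  by (simp add: attempts_def space_PiM)

lemma measurable_completion_time [measurable]:
  "completion_time \<in> attempts q D \<rightarrow>\<^sub>M count_space UNIV"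
proof -
  have duration_m: "(\<lambda>\<omega>. \<Sum>i\<le>n. duration (\<omega> i)) \<in> attempts q D \<rightarrow>\<^sub>M count_space UNIV" for n
    by measurable
  have least_m: "(\<lambda>\<omega>. LEAST i. succeeds (\<omega> i)) \<in> attempts q D \<rightarrow>\<^sub>M count_space UNIV"
    by measurable
  note [measurable] = measurable_compose_countable[OF duration_m least_m]
  show ?thesis
    unfolding completion_time_def[abs_def] by measurable
qed

lemma sets_completion_time_gt: "{\<omega>. n < completion_time \<omega>} \<in> sets (attempts q D)"
proof -
  have "{\<omega>\<in>space (attempts q D). n < completion_time \<omega>} \<in> sets (attempts q D)"
    by measurable
  then show ?thesis by simp
qed

lemma prob_space_attempts: "prob_space (attempts q D)"
  unfolding attempts_def by (intro prob_space_PiM measure_pmf.prob_space_axioms)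

text \<open>Prepending an independent coordinate to an i.i.d. sequence reproduces its law
  (\<open>PiM_iter\<close>), so Fubini integrates over the prepended one. This is how conditioning
  on the first attempt is expressed below.\<close>

lemma prob_attempts_split:
  assumes A: "A \<in> sets (attempts q D)"
  shows "measure (attempts q D) A =
    (\<integral>a. measure (attempts q D) {\<omega>. case_nat a \<omega> \<in> A}
       \<partial>measure_pmf (pair_pmf D (catastrophe_time_pmf q)))"
proof -
  define M where "M = measure_pmf (pair_pmf D (catastrophe_time_pmf q))"
  interpret product_prob_space "\<lambda>_::nat. M" UNIV
    unfolding M_def by unfold_locales
  interpret sequence_space M ..
  have S: "attempts q D = S"
    by (simp add: attempts_def M_def)
  interpret P: prob_space S
    using prob_space_attempts[of q D] by (simp add: S)
  define F :: "(nat \<times> nat) \<times> (nat \<Rightarrow> nat \<times> nat) \<Rightarrow> nat \<Rightarrow> nat \<times> nat"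
    where "F = (\<lambda>(s, \<omega>). case_nat s \<omega>)"
  have F: "F \<in> M \<Otimes>\<^sub>M S \<rightarrow>\<^sub>M S"
    unfolding F_def by measurable
  have sp: "space (M \<Otimes>\<^sub>M S) = UNIV"
    by (simp add: space_pair_measure M_def space_PiM)
  have AS: "A \<in> sets S"
    using A by (simp add: S)
  have pre: "F -` A \<in> sets (M \<Otimes>\<^sub>M S)"
    using measurable_sets[OF F AS] by (simp add: sp)
  have "emeasure S A = emeasure (distr (M \<Otimes>\<^sub>M S) S F) A"
    unfolding F_def PiM_iter ..
  also have "\<dots> = emeasure (M \<Otimes>\<^sub>M S) (F -` A)"
    using emeasure_distr[OF F AS] by (simp add: sp)
  also have "\<dots> = (\<integral>\<^sup>+a. emeasure S (Pair a -` F -` A) \<partial>M)"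
    by (rule P.emeasure_pair_measure_alt[OF pre])
  also have "\<dots> = (\<integral>\<^sup>+a. ennreal (measure S {\<omega>. case_nat a \<omega> \<in> A}) \<partial>M)"
    by (simp add: P.emeasure_eq_measure F_def vimage_def)
  also have "\<dots> = ennreal (\<integral>a. measure S {\<omega>. case_nat a \<omega> \<in> A} \<partial>M)"
    by (intro nn_integral_eq_integral)
       (auto simp: M_def intro!: measure_pmf.integrable_const_bound[where B=1] P.prob_le_1[unfolded M_def])
  finally have "measure S A = (\<integral>a. measure S {\<omega>. case_nat a \<omega> \<in> A} \<partial>M)"
    by (simp add: P.emeasure_eq_measure)
  then show ?thesis
    by (simp add: S M_def)
qed

lemma completion_time_case_nat_succeeds:
  "succeeds a \<Longrightarrow> completion_time (case_nat a \<omega>) = duration a"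
proof -
  assume True: "succeeds a"
  then have "(LEAST i. succeeds (case_nat a \<omega> i)) = 0"
    by (intro Least_equality) auto
  moreover have "\<exists>i. succeeds (case_nat a \<omega> i)"
    using True by (intro exI[of _ 0]) simp
  ultimately show ?thesis
    using True by (simp add: completion_time_def)
qed

text \<open>The hypothesis excludes the default value 0 of \<open>completion_time\<close>: if
  \<open>a\<close> fails and nothing in \<omega> succeeds, the left side is 0 while the right side
  is \<open>duration a\<close>.\<close>

lemma completion_time_case_nat:
  assumes "\<exists>i. succeeds (\<omega> i)"
  shows "completion_time (case_nat a \<omega>) =
    (if succeeds a then duration a else duration a + completion_time \<omega>)"
proof (cases "succeeds a")
  case True
  then show ?thesis
    by (simp add: completion_time_case_nat_succeeds)
next
  case False
  have ex: "\<exists>i. succeeds (case_nat a \<omega> i)"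
    using assms by (metis nat.case(2))
  then obtain n where n: "succeeds (case_nat a \<omega> n)"
    by blast
  have "(LEAST i. succeeds (case_nat a \<omega> i)) = Suc (LEAST i. succeeds (\<omega> i))"
    using Least_Suc[where P = "\<lambda>i. succeeds (case_nat a \<omega> i)", OF n] False by simp
  then show ?thesis
    using ex assms False by (simp add: completion_time_def sum.atMost_Suc_shift del: sum.atMost_Suc)
qed

section \<open>The catastrophe time, and almost sure success\<close>

lemma pmf_catastrophe_time:
  assumes "0 < q" "q < 1"
  shows "pmf (catastrophe_time_pmf q) (Suc n) = q * (1 - q) ^ n"
  using assms by (simp add: catastrophe_time_pmf_def pmf_map_inj')

lemma pmf_catastrophe_time_0:
  shows "pmf (catastrophe_time_pmf q) 0 = 0"
  by (simp add: catastrophe_time_pmf_def pmf_eq_0_set_pmf)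

lemma prob_catastrophe_time_gt:
  assumes "0 < q" "q < 1"
  shows "measure_pmf.prob (catastrophe_time_pmf q) {n<..} = (1 - q) ^ n"
proof -
  have "measure_pmf.prob (catastrophe_time_pmf q) {..n} = (\<Sum>k\<le>n. pmf (catastrophe_time_pmf q) k)"
    by (simp add: measure_measure_pmf_finite)
  also have "\<dots> = (\<Sum>k<n. q * (1 - q) ^ k)"
    using assms by (simp add: pmf_catastrophe_time pmf_catastrophe_time_0 lessThan_Suc_atMost[symmetric]
      sum.lessThan_Suc_shift del: sum.lessThan_Suc)
  also have "\<dots> = 1 - (1 - q) ^ n"
    using assms by (simp add: sum_distrib_left[symmetric] sum_gp_strict)
  finally have "measure_pmf.prob (catastrophe_time_pmf q) {..n} = 1 - (1 - q) ^ n" .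
  moreover have "{n<..} = UNIV - {..n}" by auto
  ultimately show ?thesis
    using measure_pmf.prob_compl[of "{..n}" "catastrophe_time_pmf q"] by simp
qed

text \<open>The event that every attempt fails is preserved by dropping the first attempt, so its
  probability equals itself times the failure probability of one attempt. As that factor is not 1,
  the event is null.\<close>

lemma AE_some_attempt_succeeds:
  assumes "0 < q" "q < 1"
  shows "AE \<omega> in attempts q D. \<exists>i. succeeds (\<omega> i)"
proof -
  let ?X = "pair_pmf D (catastrophe_time_pmf q)"
  interpret P: prob_space "attempts q D" by (rule prob_space_attempts)
  define N :: "(nat \<Rightarrow> nat \<times> nat) set" where "N = {\<omega>. \<forall>i. \<not> succeeds (\<omega> i)}"
  have N: "N \<in> sets (attempts q D)"
  proof -
    have "{\<omega>\<in>space (attempts q D). \<forall>i. \<not> succeeds (\<omega> i)} \<in> sets (attempts q D)"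
      by measurable
    then show ?thesis by (simp add: N_def)
  qed
  have iff: "(\<forall>i. \<not> succeeds (case_nat a \<omega> i)) \<longleftrightarrow> \<not> succeeds a \<and> (\<forall>i. \<not> succeeds (\<omega> i))" for a \<omega>
    by (auto split: nat.split)
  have "P.prob N = (\<integral>a. P.prob {\<omega>. case_nat a \<omega> \<in> N} \<partial>?X)"
    by (rule prob_attempts_split[OF N])
  also have "\<dots> = (\<integral>a. P.prob N * indicator {a. \<not> succeeds a} a \<partial>?X)"
    by (intro Bochner_Integration.integral_cong) (auto simp: N_def iff split: split_indicator)
  finally have "P.prob N = P.prob N * measure_pmf.prob ?X {a. \<not> succeeds a}"
    by simp
  moreover have "measure_pmf.prob ?X {a. \<not> succeeds a} \<noteq> 1"
  proof
    assume "measure_pmf.prob ?X {a. \<not> succeeds a} = 1"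
    then have "AE a in ?X. \<not> succeeds a"
      by (subst (asm) measure_pmf.prob_eq_1) auto
    moreover obtain k where "k \<in> set_pmf D"
      using set_pmf_not_empty[of D] by blast
    \<comment> \<open>The outcome \<open>(k, Suc k)\<close> succeeds and has positive mass.\<close>
    moreover have "pmf (catastrophe_time_pmf q) (Suc k) \<noteq> 0"
      using assms by (simp add: pmf_catastrophe_time)
    ultimately show False
      by (auto simp: AE_measure_pmf_iff set_pmf_eq succeeds_def pmf_pair)
  qed
  ultimately have "P.prob N = 0"
    by simp
  then have "AE \<omega> in attempts q D. \<omega> \<notin> N"
    using N by (simp add: P.prob_eq_0)
  then show ?thesis
    by eventually_elim (auto simp: N_def)
qed

section \<open>The renewal equation for the tail of the completion time\<close>

definition completion_tail :: "real \<Rightarrow> nat pmf \<Rightarrow> nat \<Rightarrow> real" where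
  "completion_tail q D n = measure (attempts q D) {\<omega>. n < completion_time \<omega>}"

text \<open>T exceeds n if the first attempt lasts longer than n steps, or if it fails at some t
  \<le> n and the later attempts together take more than n - t steps. The sum uses k = t -
  1.\<close>

lemma completion_tail_renewal:
  assumes "0 < q" "q < 1"
  shows "completion_tail q D n = (1 - q) ^ n * measure_pmf.prob D {n<..} +
    (\<Sum>k<n. q * (1 - q) ^ k * measure_pmf.prob D {k<..} * completion_tail q D (n - Suc k))"
proof -
  let ?C = "catastrophe_time_pmf q"
  let ?X = "pair_pmf D ?C"
  interpret P: prob_space "attempts q D" by (rule prob_space_attempts)
  define E where "E t = {a. duration a = t \<and> \<not> succeeds a}" for t
  \<comment> \<open>Success requires the strict inequality, so a tie is a failure: a failed attempt
    of length t has catastrophe time exactly t and base time at least t.\<close>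
  have E_eq: "E t = {t..} \<times> {t}" for t
    by (auto simp: E_def duration_def succeeds_def)
  have gt_eq: "{a. n < duration a} = {n<..} \<times> {n<..}"
    by (auto simp: duration_def)
  have first: "P.prob {\<omega>. n < completion_time (case_nat a \<omega>)} =
      indicator {a. n < duration a} a + (\<Sum>t\<le>n. indicator (E t) a * completion_tail q D (n - t))" for a
  proof (cases "succeeds a")
    case True
    then show ?thesis
      by (auto simp: completion_time_case_nat_succeeds E_def P.prob_space[simplified]
          split: split_indicator)
  next
    case False
    \<comment> \<open>The pointwise identity for a prepended failure can break only where no attempt
      succeeds, because of the default value there. That event is null, so almost everywhere
      equality is enough.\<close>
    have "P.prob {\<omega>. n < completion_time (case_nat a \<omega>)} = P.prob {\<omega>. n < duration a + completion_time \<omega>}"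
    proof (rule P.finite_measure_eq_AE)
      show "AE \<omega> in attempts q D. (\<omega> \<in> {\<omega>. n < completion_time (case_nat a \<omega>)}) =
          (\<omega> \<in> {\<omega>. n < duration a + completion_time \<omega>})"
        using AE_some_attempt_succeeds[OF assms]
        by eventually_elim (use False in \<open>auto simp: completion_time_case_nat\<close>)
      have "{\<omega>\<in>space (attempts q D). n < duration a + completion_time \<omega>} \<in> sets (attempts q D)"
        by measurable
      then show "{\<omega>. n < duration a + completion_time \<omega>} \<in> sets (attempts q D)" by simp
      have cn: "case_nat a \<in> attempts q D \<rightarrow>\<^sub>M attempts q D"
      proof -
        have "(\<lambda>\<omega>. case_nat a \<omega> i) \<in> attempts q D \<rightarrow>\<^sub>M measure_pmf ?X" for i
          by (cases i) (simp_all cong: measurable_cong_sets)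
        then show ?thesis
          unfolding attempts_def[of q D]
          by (intro measurable_PiM_single') (auto simp: attempts_def)
      qed
      show "{\<omega>. n < completion_time (case_nat a \<omega>)} \<in> sets (attempts q D)"
        using measurable_sets[OF cn sets_completion_time_gt[of n]] by (simp add: vimage_def)
    qed
    also have "\<dots> = indicator {a. n < duration a} a + (\<Sum>t\<le>n. indicator (E t) a * completion_tail q D (n - t))"
    proof (cases "n < duration a")
      case True
      then show ?thesis
        by (auto simp: E_def P.prob_space[simplified] split: split_indicator)
    next
      case le: False
      have "(\<Sum>t\<le>n. indicator (E t) a * completion_tail q D (n - t)) = completion_tail q D (n - duration a)"
        using le False by (subst sum.remove[of _ "duration a"]) (auto simp: E_def)
      moreover have "{\<omega>. n < duration a + completion_time \<omega>} = {\<omega>. n - duration a < completion_time \<omega>}"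
        using le by auto
      ultimately show ?thesis
        using le by (simp add: completion_tail_def)
    qed
    finally show ?thesis .
  qed
  have int: "integrable (measure_pmf ?X) (\<lambda>a. indicator B a * c :: real)" for B c
    by (rule measure_pmf.integrable_const_bound[where B="\<bar>c\<bar>"]) (auto split: split_indicator)
  have int1: "integrable (measure_pmf ?X) (\<lambda>a. indicator B a :: real)" for B
    by (rule measure_pmf.integrable_const_bound[where B=1]) (auto split: split_indicator)
  have "completion_tail q D n = (\<integral>a. P.prob {\<omega>. n < completion_time (case_nat a \<omega>)} \<partial>?X)"
    unfolding completion_tail_def by (subst prob_attempts_split[OF sets_completion_time_gt]) simp
  also have "\<dots> = (\<integral>a. indicator {a. n < duration a} a +
      (\<Sum>t\<le>n. indicator (E t) a * completion_tail q D (n - t)) \<partial>?X)"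
    by (simp only: first)
  also have "\<dots> = measure_pmf.prob ?X {a. n < duration a} +
      (\<Sum>t\<le>n. measure_pmf.prob ?X (E t) * completion_tail q D (n - t))"
    by (subst Bochner_Integration.integral_add)
       (simp_all add: int int1 Bochner_Integration.integral_sum
         del: sum_mult_indicator sum_indicator_mult)
  also have "measure_pmf.prob ?X {a. n < duration a} = (1 - q) ^ n * measure_pmf.prob D {n<..}"
    unfolding gt_eq by (simp add: measure_pmf_prob_product prob_catastrophe_time_gt assms)
  also have "(\<Sum>t\<le>n. measure_pmf.prob ?X (E t) * completion_tail q D (n - t)) =
      (\<Sum>t\<le>n. pmf ?C t * measure_pmf.prob D {t..} * completion_tail q D (n - t))"
    unfolding E_eq by (simp add: measure_pmf_prob_product measure_pmf_single mult_ac)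
  \<comment> \<open>The catastrophe time has no mass at 0, so the sum starts at t = 1 and is shifted
    by one.\<close>
  also have "\<dots> = (\<Sum>k<n. q * (1 - q) ^ k * measure_pmf.prob D {k<..} * completion_tail q D (n - Suc k))"
    by (simp add: lessThan_Suc_atMost[symmetric] sum.lessThan_Suc_shift pmf_catastrophe_time_0
        pmf_catastrophe_time assms atLeast_Suc_greaterThan del: sum.lessThan_Suc)
  finally show ?thesis .
qed

lemma completion_tail_nonneg [simp]: "0 \<le> completion_tail q D n"
  by (simp add: completion_tail_def)

lemma completion_tail_le_1: "completion_tail q D n \<le> 1"
proof -
  interpret prob_space "attempts q D" by (rule prob_space_attempts)
  show ?thesis by (simp add: completion_tail_def)
qed

lemma completion_tail_antimono: "m \<le> n \<Longrightarrow> completion_tail q D n \<le> completion_tail q D m"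
proof -
  assume "m \<le> n"
  interpret prob_space "attempts q D" by (rule prob_space_attempts)
  show ?thesis
    unfolding completion_tail_def using \<open>m \<le> n\<close>
    by (intro finite_measure_mono sets_completion_time_gt) auto
qed

lemma completion_tail_0:
  assumes "0 < q" "q < 1" "pmf D 0 = 0"
  shows "completion_tail q D 0 = 1"
proof -
  have "measure_pmf.prob D {0<..} = 1"
    using assms(3) by (subst measure_pmf.prob_eq_1) (auto simp: AE_measure_pmf_iff set_pmf_eq intro!: Nat.gr0I)
  then show ?thesis
    using completion_tail_renewal[OF assms(1,2), of D 0] by simp
qed

section \<open>Weights of successful attempts and the telescoped recursion\<close>

text \<open>For 0 < q < 1 this is the probability that an attempt succeeds and lasts exactly k
  steps: the base time is k and the catastrophe comes later.\<close>

definition damped :: "real \<Rightarrow> nat pmf \<Rightarrow> nat \<Rightarrow> real" where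
  "damped q D k = pmf D k * (1 - q) ^ k"

lemma damped_nonneg: "q \<le> 1 \<Longrightarrow> 0 \<le> damped q D k"
  by (simp add: damped_def)

lemma damped_sums_pgf:
  assumes "0 \<le> q" "q \<le> 1"
  shows "damped q D sums pgf D (1 - q)"
proof -
  have eq: "damped q D = (\<lambda>k. pmf D k *\<^sub>R (1 - q) ^ k)"
    by (auto simp: damped_def)
  have "integrable (measure_pmf D) (\<lambda>k. (1 - q) ^ k)"
    using assms by (intro measure_pmf.integrable_const_bound[where B=1]) (auto simp: power_le_one)
  then have int: "integrable (count_space UNIV) (\<lambda>k. pmf D k *\<^sub>R (1 - q) ^ k)"
    by (simp add: measure_pmf_eq_density integrable_density)
  have "pgf D (1 - q) = (\<integral>k. pmf D k *\<^sub>R (1 - q) ^ k \<partial>count_space UNIV)"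
    by (simp add: pgf_def measure_pmf_eq_density integral_density)
  then show ?thesis
    unfolding eq using sums_integral_count_space_nat[OF int] by simp
qed

lemma sum_damped_le_pgf:
  assumes "0 \<le> q" "q \<le> 1"
  shows "(\<Sum>k\<le>n. damped q D k) \<le> pgf D (1 - q)"
  using sum_le_suminf[OF sums_summable[OF damped_sums_pgf[OF assms]], of "{..n}" D]
    damped_sums_pgf[OF assms, of D] assms
  by (simp add: sums_iff damped_nonneg)

lemma pgf_pos:
  assumes "0 \<le> q" "q < 1"
  shows "0 < pgf D (1 - q)"
proof -
  obtain k where "k \<in> set_pmf D"
    using set_pmf_not_empty[of D] by blast
  then have "0 < damped q D k"
    using assms by (simp add: damped_def pmf_positive)
  also have "\<dots> \<le> (\<Sum>k\<le>k. damped q D k)"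
    using assms by (intro member_le_sum) (auto simp: damped_nonneg)
  also have "\<dots> \<le> pgf D (1 - q)"
    using assms by (intro sum_damped_le_pgf) auto
  finally show ?thesis .
qed

lemma pgf_less_1:
  assumes "0 < q" "q < 1" "pmf D 0 = 0"
  shows "pgf D (1 - q) < 1"
proof -
  have "pgf D (1 - q) \<le> (\<integral>k. 1 - q \<partial>measure_pmf D)"
    unfolding pgf_def
  proof (rule integral_mono_AE)
    show "integrable (measure_pmf D) (\<lambda>k. (1 - q) ^ k)"
      using assms by (intro measure_pmf.integrable_const_bound[where B=1]) (auto simp: power_le_one)
    show "AE k in measure_pmf D. (1 - q) ^ k \<le> 1 - q"
    proof (rule AE_pmfI)
      fix k assume "k \<in> set_pmf D"
      then have "1 \<le> k"
        using assms(3) by (cases k) (auto simp: set_pmf_eq)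
      then show "(1 - q) ^ k \<le> 1 - q"
        using assms power_decreasing[of 1 k "1 - q"] by simp
    qed
  qed simp
  then show ?thesis
    using assms by simp
qed

text \<open>Subtracting \<^term>\<open>(1 - q) * completion_tail q D n\<close> from the renewal equation turns the tail
  probabilities of the base time into its point masses.\<close>

lemma completion_tail_Suc:
  assumes q: "0 < q" "q < 1" and D: "pmf D 0 = 0"
  shows "completion_tail q D (Suc n) =
    completion_tail q D n - q * (\<Sum>k\<le>n. damped q D k * completion_tail q D (n - k)) - damped q D (Suc n)"
proof -
  define s where "s = 1 - q"
  define G where "G k = measure_pmf.prob D {k<..}" for k
  define a where "a = completion_tail q D"
  have G0: "G 0 = 1"
    unfolding G_def using D
    by (subst measure_pmf.prob_eq_1) (auto simp: AE_measure_pmf_iff set_pmf_eq intro!: Nat.gr0I)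
  have G_Suc: "G (Suc k) = G k - pmf D (Suc k)" for k
  proof -
    have "{k<..} = insert (Suc k) {Suc k<..}" by auto
    then show ?thesis
      by (simp add: G_def measure_pmf.finite_measure_Union[of "{Suc k}", simplified] measure_pmf_single)
  qed
  have ren: "a m = s ^ m * G m + (\<Sum>k<m. q * s ^ k * G k * a (m - Suc k))" for m
    unfolding a_def s_def G_def by (rule completion_tail_renewal[OF q])
  have "a (Suc n) = s ^ Suc n * G (Suc n) + q * a n +
      (\<Sum>k<n. q * s ^ Suc k * G (Suc k) * a (n - Suc k))"
    by (subst ren) (simp add: sum.lessThan_Suc_shift G0 del: sum.lessThan_Suc)
  \<comment> \<open>Every shifted term carries one more factor s, and \<open>G (Suc k)\<close> is
    \<open>G k\<close> minus a point mass. Hence s times the renewal equation at n separates from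
    the sum.\<close>
  also have "\<dots> = s * (s ^ n * G n + (\<Sum>k<n. q * s ^ k * G k * a (n - Suc k))) + q * a n
      - s ^ Suc n * pmf D (Suc n) - q * (\<Sum>k<n. s ^ Suc k * pmf D (Suc k) * a (n - Suc k))"
    by (simp add: G_Suc sum_distrib_left sum_subtractf algebra_simps)
  also have "\<dots> = s * a n + q * a n - damped q D (Suc n)
      - q * (\<Sum>k<n. damped q D (Suc k) * a (n - Suc k))"
    by (simp only: ren[of n, symmetric]) (simp add: damped_def s_def mult_ac)
  \<comment> \<open>The k = 0 term may be added since \<open>pmf D 0 = 0\<close>.\<close>
  also have "(\<Sum>k<n. damped q D (Suc k) * a (n - Suc k)) = (\<Sum>k\<le>n. damped q D k * a (n - k))"
    by (simp add: lessThan_Suc_atMost[symmetric] sum.lessThan_Suc_shift damped_def D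
        del: sum.lessThan_Suc)
  finally show ?thesis
    by (simp add: a_def s_def algebra_simps)
qed

section \<open>The mean completion time\<close>

text \<open>Keep a single weight c_j > 0 of the convolution in the recursion. Since the tail is
  decreasing, a_(n-j) \<ge> a_n, and each step from n \<ge> j on contracts by the factor 1 - q
  c_j.\<close>

lemma summable_completion_tail:
  assumes q: "0 < q" "q < 1" and D: "pmf D 0 = 0"
  shows "summable (completion_tail q D)"
proof -
  obtain j where "j \<in> set_pmf D"
    using set_pmf_not_empty[of D] by blast
  then have j: "0 < damped q D j"
    using q by (simp add: damped_def pmf_positive)
  show ?thesis
  proof (rule summable_ratio_test)
    show "1 - q * damped q D j < 1"
      using q j by simp
    fix n assume "j \<le> n"
    define S where "S = (\<Sum>k\<le>n. damped q D k * completion_tail q D (n - k))"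
    have "damped q D j * completion_tail q D n \<le> damped q D j * completion_tail q D (n - j)"
      using j by (intro mult_left_mono completion_tail_antimono) auto
    also have "\<dots> \<le> S"
      unfolding S_def using \<open>j \<le> n\<close> q
      by (intro member_le_sum[where f = "\<lambda>k. damped q D k * completion_tail q D (n - k)"])
         (auto simp: damped_nonneg)
    finally have "q * (damped q D j * completion_tail q D n) \<le> q * S"
      using q by (intro mult_left_mono) auto
    moreover have "completion_tail q D (Suc n) \<le> completion_tail q D n - q * S"
      using completion_tail_Suc[OF assms, of n] damped_nonneg[of q D "Suc n"] q by (simp add: S_def)
    ultimately have "completion_tail q D (Suc n) \<le> (1 - q * damped q D j) * completion_tail q D n"
      by (simp add: left_diff_distrib mult.assoc)
    then show "norm (completion_tail q D (Suc n)) \<le> (1 - q * damped q D j) * norm (completion_tail q D n)"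
      by simp
  qed
qed

text \<open>Sum the recursion over all n. The differences telescope to -a_0 = -1, the convolution
  becomes the Cauchy product p times the sum of the tail, and the remaining masses add up to p - c_0
  = p. Solving this linear equation gives the value.\<close>

lemma suminf_completion_tail:
  assumes q: "0 < q" "q < 1" and D: "pmf D 0 = 0"
  shows "suminf (completion_tail q D) = (1 - pgf D (1 - q)) / (q * pgf D (1 - q))"
proof -
  let ?p = "pgf D (1 - q)"
  have c: "damped q D sums ?p"
    using q by (intro damped_sums_pgf) auto
  have summ: "summable (\<lambda>k. norm (completion_tail q D k))" "summable (\<lambda>k. norm (damped q D k))"
    using summable_completion_tail[OF assms] sums_summable[OF c] q by (simp_all add: damped_nonneg)
  have "(\<lambda>n. completion_tail q D (Suc n) - completion_tail q D n) sums (0 - completion_tail q D 0)"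
    by (intro telescope_sums summable_LIMSEQ_zero summable_completion_tail assms)
  moreover have "(\<lambda>n. completion_tail q D (Suc n) - completion_tail q D n) =
      (\<lambda>n. - (q * (\<Sum>k\<le>n. damped q D k * completion_tail q D (n - k))) - damped q D (Suc n))"
    by (simp add: completion_tail_Suc[OF assms])
  moreover have "(\<lambda>n. - (q * (\<Sum>k\<le>n. damped q D k * completion_tail q D (n - k))) - damped q D (Suc n))
      sums (- (q * (?p * suminf (completion_tail q D))) - (?p - damped q D 0))"
    using Cauchy_product_sums[OF summ(2,1)] c
    by (intro sums_diff sums_minus sums_mult) (simp_all add: sums_iff suminf_split_head summable_Suc_iff)
  ultimately have "- 1 = - (q * (?p * suminf (completion_tail q D))) - ?p"
    by (simp add: completion_tail_0[OF assms] damped_def D sums_unique2)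
  then show ?thesis
    using q pgf_pos[of q D] by (simp add: field_simps)
qed

lemma mean_completion_time_eq:
  assumes q: "0 < q" "q < 1" and D: "pmf D 0 = 0"
  shows "mean_completion_time q D = (1 - pgf D (1 - q)) / (q * pgf D (1 - q))"
proof -
  interpret P: prob_space "attempts q D" by (rule prob_space_attempts)
  \<comment> \<open>The nonnegative integral is evaluated as the sum of tails without assuming that
    T is integrable.\<close>
  have "(\<integral>\<^sup>+\<omega>. ennreal (real (completion_time \<omega>)) \<partial>attempts q D) =
      (\<Sum>n. ennreal (completion_tail q D n))"
    using nn_integral_nat_function[OF measurable_completion_time[of q D]]
    by (simp add: ennreal_of_nat_eq_real_of_nat completion_tail_def P.emeasure_eq_measure)
  also have "\<dots> = ennreal (suminf (completion_tail q D))"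
    by (intro suminf_ennreal2 summable_completion_tail assms) simp
  finally show ?thesis
    unfolding mean_completion_time_def
    by (subst integral_eq_nn_integral)
       (auto simp: suminf_completion_tail[OF assms, symmetric] suminf_nonneg summable_completion_tail assms)
qed

section \<open>Comparison of the tail with a geometric sequence\<close>

text \<open>The error is multiplied by B at each step before new errors are added. The constant part
  \<eta> therefore accumulates to at most a geometric series, while for \<open>t\<close> the
  contraction is only used as B \<le> 1, so its terms simply add up.\<close>

lemma geometric_perturbation:
  fixes a t :: "nat \<Rightarrow> real"
  assumes B: "0 \<le> B" "B < 1" and "a 0 = 1" "0 \<le> \<eta>" and t: "\<And>n. 0 \<le> t n"
    and step: "\<And>n. \<bar>a (Suc n) - B * a n\<bar> \<le> \<eta> + t n"
  shows "\<bar>a n - B ^ n\<bar> \<le> \<eta> / (1 - B) + (\<Sum>j<n. t j)"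
proof (induction n)
  case 0
  then show ?case using assms by simp
next
  case (Suc n)
  have T: "0 \<le> (\<Sum>j<n. t j)"
    by (intro sum_nonneg t)
  have "\<bar>a (Suc n) - B ^ Suc n\<bar> \<le> \<bar>a (Suc n) - B * a n\<bar> + \<bar>B * (a n - B ^ n)\<bar>"
    by (simp add: algebra_simps)
  also have "\<bar>B * (a n - B ^ n)\<bar> = B * \<bar>a n - B ^ n\<bar>"
    using B by (simp add: abs_mult)
  also have "\<dots> \<le> B * (\<eta> / (1 - B) + (\<Sum>j<n. t j))"
    using B by (intro mult_left_mono Suc.IH)
  also have "\<dots> \<le> B * (\<eta> / (1 - B)) + (\<Sum>j<n. t j)"
    using B T mult_left_le_one_le[OF T] by (simp add: distrib_left)
  also note step[of n]
  finally have "\<bar>a (Suc n) - B ^ Suc n\<bar> \<le> \<eta> + B * (\<eta> / (1 - B)) + (\<Sum>j<Suc n. t j)"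
    by simp
  also have "\<eta> + B * (\<eta> / (1 - B)) = \<eta> / (1 - B)"
    using B by (simp add: field_simps)
  finally show ?case .
qed

text \<open>After exchanging the sums, c_k occurs in the n-th remainder exactly when n < k, hence at
  most k times.\<close>

lemma sum_remainders_le:
  fixes c :: "nat \<Rightarrow> real"
  assumes c: "\<And>k. 0 \<le> c k" "c sums p" and R: "(\<lambda>k. real k * c k) sums R"
  shows "(\<Sum>n<m. p - (\<Sum>k\<le>n. c k)) \<le> R"
proof (rule sums_le)
  show "(\<lambda>k. \<Sum>n<m. c k - (if k \<in> {..n} then c k else 0)) sums (\<Sum>n<m. p - (\<Sum>k\<le>n. c k))"
    by (intro sums_sum sums_diff c sums_If_finite_set) auto
  fix k
  have "(\<Sum>n<m. c k - (if k \<in> {..n} then c k else 0)) = (\<Sum>n<m. if n < k then c k else 0)"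
    by (intro sum.cong) auto
  also have "\<dots> = (\<Sum>n\<in>{..<m} \<inter> {..<k}. c k)"
    by (simp add: sum.If_cases lessThan_def)
  also have "\<dots> \<le> (\<Sum>n\<in>{..<k}. c k)"
    by (intro sum_mono2) (auto simp: c)
  finally show "(\<Sum>n<m. c k - (if k \<in> {..n} then c k else 0)) \<le> real k * c k"
    by simp
qed (rule R)

text \<open>One step lowers the tail by at most c_0 + ... + c_(n+1) \<le> p, by the recursion with q
  \<le> 1 and tails bounded by 1.\<close>

lemma completion_tail_diff_le:
  assumes q: "0 < q" "q < 1" and D: "pmf D 0 = 0"
  shows "completion_tail q D n - completion_tail q D (n + k) \<le> real k * pgf D (1 - q)"
proof (induction k)
  case (Suc k)
  let ?n = "n + k"
  have "q * (\<Sum>k\<le>?n. damped q D k * completion_tail q D (?n - k)) \<le> 1 * (\<Sum>k\<le>?n. damped q D k * 1)"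
    using q by (intro mult_mono sum_mono mult_left_mono sum_nonneg mult_nonneg_nonneg)
      (auto simp: damped_nonneg completion_tail_le_1)
  then have "completion_tail q D ?n - completion_tail q D (Suc ?n) \<le> (\<Sum>k\<le>Suc ?n. damped q D k)"
    by (simp add: completion_tail_Suc[OF assms])
  also have "\<dots> \<le> pgf D (1 - q)"
    using q by (intro sum_damped_le_pgf) auto
  finally show ?case
    using Suc.IH by (simp add: algebra_simps)
qed simp

text \<open>Two replacements are made in the recursion: a_(n-k) by a_n, which costs k p per weight
  c_k and so q p R in total, and the partial sum of weights by p, whose deficit also bounds
  c_(n+1).\<close>

lemma completion_tail_step:
  assumes q: "0 < q" "q < 1" and D: "pmf D 0 = 0"
    and R: "(\<lambda>k. real k * damped q D k) sums R"
  defines "p \<equiv> pgf D (1 - q)"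
  shows "\<bar>completion_tail q D (Suc n) - (1 - q * p) * completion_tail q D n\<bar> \<le>
    q * p * R + (p - (\<Sum>k\<le>n. damped q D k))"
proof -
  let ?c = "damped q D" and ?a = "completion_tail q D"
  define X where "X = (\<Sum>k\<le>n. ?c k * (?a (n - k) - ?a n))"
  define t where "t = p - (\<Sum>k\<le>n. ?c k)"
  have p: "0 < p"
    unfolding p_def using q by (intro pgf_pos) auto
  have c: "0 \<le> ?c k" for k
    using q by (simp add: damped_nonneg)
  have X0: "0 \<le> X"
    unfolding X_def by (intro sum_nonneg mult_nonneg_nonneg c) (simp add: completion_tail_antimono)
  have "X \<le> (\<Sum>k\<le>n. p * (real k * ?c k))"
    unfolding X_def
  proof (rule sum_mono)
    fix k assume "k \<in> {..n}"
    then have "?a (n - k) - ?a n \<le> real k * p"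
      using completion_tail_diff_le[OF q D, of "n - k" k] by (simp add: p_def)
    from mult_left_mono[OF this c[of k]]
    show "?c k * (?a (n - k) - ?a n) \<le> p * (real k * ?c k)"
      by (simp add: mult_ac)
  qed
  also have "\<dots> = p * (\<Sum>k\<le>n. real k * ?c k)"
    by (simp add: sum_distrib_left)
  also have "(\<Sum>k\<le>n. real k * ?c k) \<le> R"
    using sum_le_suminf[OF sums_summable[OF R], of "{..n}"] R c by (simp add: sums_iff)
  finally have XR: "X \<le> p * R"
    using p by simp
  have cn: "?c (Suc n) \<le> t"
    using sum_damped_le_pgf[of q D "Suc n"] q by (simp add: t_def p_def)
  have "q * t * ?a n \<le> 1 * t * 1"
    using q cn c[of "Suc n"] by (intro mult_mono) (auto simp: completion_tail_le_1)
  moreover have "0 \<le> q * t * ?a n"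
    using q cn c[of "Suc n"] by simp
  \<comment> \<open>The first term on the right lies in [0, t], the second subtracts at most q p R,
    and the third subtracts at most t, so the total is within q p R + t of 0.\<close>
  moreover have "?a (Suc n) - (1 - q * p) * ?a n = q * t * ?a n - q * X - ?c (Suc n)"
    by (simp add: completion_tail_Suc[OF q D] X_def t_def sum_subtractf sum_distrib_left sum_distrib_right algebra_simps)
  moreover have "q * X \<le> q * (p * R)" "0 \<le> q * X"
    using q X0 XR by auto
  ultimately show ?thesis
    using cn c[of "Suc n"] by (simp add: t_def[symmetric] abs_le_iff)
qed

lemma completion_tail_close_to_exp:
  assumes q: "0 < q" "q < 1" and D: "pmf D 0 = 0"
    and R: "(\<lambda>k. real k * damped q D k) sums R"
  defines "p \<equiv> pgf D (1 - q)"
  defines "\<mu> \<equiv> q * p / (1 - p)"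
  assumes \<mu>: "\<mu> \<le> 1 / 2"
  shows "\<bar>completion_tail q D n - exp (- \<mu>) ^ n\<bar> \<le> 3 * R + 2 * p + 2 * \<mu>"
proof -
  let ?c = "damped q D"
  define B where "B = exp (- \<mu>)"
  define t where "t n = p - (\<Sum>k\<le>n. ?c k)" for n
  define \<eta> where "\<eta> = q * p * R + \<mu> * (p + \<mu>)"
  have p: "0 < p" "p < 1"
    unfolding p_def using q D by (auto intro: pgf_pos pgf_less_1)
  have mu: "0 < \<mu>"
    using p q by (simp add: \<mu>_def)
  have R0: "0 \<le> R"
    using q by (intro sums_le[OF _ sums_zero R]) (auto simp: damped_nonneg)
  have lower: "1 - \<mu> \<le> B"
    unfolding B_def using exp_ge_add_one_self[of "- \<mu>"] by simp
  have upper: "B \<le> 1 - \<mu> + \<mu>\<^sup>2"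
  proof -
    have "B \<le> 1 / (1 + \<mu>)"
      using exp_ge_add_one_self[of \<mu>] mu by (simp add: B_def exp_minus field_simps)
    also have "\<dots> \<le> 1 - \<mu> + \<mu>\<^sup>2"
      using mu by (simp add: field_simps power2_eq_square)
    finally show ?thesis .
  qed
  have "1 - B \<ge> \<mu> / 2"
    using upper mu \<mu> mult_left_mono[OF \<mu> less_imp_le[OF mu]] unfolding power2_eq_square by linarith
  have qp: "q * p = \<mu> * (1 - p)"
    using p by (simp add: \<mu>_def)
  \<comment> \<open>Both numbers are 1 - \<mu> to first order: 1 - q p = 1 - \<mu> + \<mu> p, and B
    lies between 1 - \<mu> and 1 - \<mu> + \<mu>^2.\<close>
  have "\<bar>1 - q * p - B\<bar> \<le> \<mu> * (p + \<mu>)"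
  proof -
    have "0 < \<mu> * p" "0 < \<mu> * \<mu>"
      using mu p by auto
    then show ?thesis
      using lower upper unfolding qp power2_eq_square right_diff_distrib distrib_left mult_1_right
      by linarith
  qed
  then have "\<bar>(1 - q * p - B) * completion_tail q D n\<bar> \<le> \<mu> * (p + \<mu>) * 1" for n
    unfolding abs_mult using mu p by (intro mult_mono) (auto simp: completion_tail_le_1)
  then have step: "\<bar>completion_tail q D (Suc n) - B * completion_tail q D n\<bar> \<le> \<eta> + t n" for n
  proof -
    have "completion_tail q D (Suc n) - B * completion_tail q D n =
        (completion_tail q D (Suc n) - (1 - q * p) * completion_tail q D n) + (1 - q * p - B) * completion_tail q D n"
      by (simp add: algebra_simps)
    moreover have "\<bar>completion_tail q D (Suc n) - (1 - q * p) * completion_tail q D n\<bar> \<le> q * p * R + t n"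
      using completion_tail_step[OF q D R, of n] by (simp add: p_def t_def)
    ultimately show ?thesis
      using \<open>\<bar>(1 - q * p - B) * completion_tail q D n\<bar> \<le> \<mu> * (p + \<mu>) * 1\<close> unfolding \<eta>_def by linarith
  qed
  have "\<bar>completion_tail q D n - B ^ n\<bar> \<le> \<eta> / (1 - B) + (\<Sum>j<n. t j)"
  proof (rule geometric_perturbation[where a = "completion_tail q D"])
    show "0 \<le> B" "B < 1" using mu by (auto simp: B_def)
    show "completion_tail q D 0 = 1" by (rule completion_tail_0[OF q D])
    show "0 \<le> \<eta>" using mu p q R0 by (simp add: \<eta>_def)
    show "0 \<le> t n" for n
      using q sum_damped_le_pgf[of q D n] by (simp add: t_def p_def)
  qed (rule step)
  moreover have "(\<Sum>j<n. t j) \<le> R"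
    unfolding t_def p_def using q
    by (intro sum_remainders_le R damped_sums_pgf) (auto simp: damped_nonneg)
  moreover have "\<eta> / (1 - B) \<le> \<eta> / (\<mu> / 2)"
    using \<open>1 - B \<ge> \<mu> / 2\<close> mu p q R0 by (intro divide_left_mono) (auto simp: \<eta>_def)
  \<comment> \<open>Each error in \<eta> contains a factor \<mu>, which cancels the 1/\<mu> coming
    from the geometric series. This keeps the bound linear in R, p and \<mu>.\<close>
  moreover have "\<eta> / (\<mu> / 2) = 2 * ((1 - p) * R) + 2 * p + 2 * \<mu>"
  proof -
    have "\<eta> = \<mu> * ((1 - p) * R + p + \<mu>)"
      unfolding \<eta>_def qp by (simp add: distrib_left mult.assoc)
    then show ?thesis
      using mu by simp
  qed
  moreover have "(1 - p) * R \<le> 1 * R"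
    using p R0 by (intro mult_right_mono) auto
  ultimately have "\<bar>completion_tail q D n - B ^ n\<bar> \<le> 3 * R + 2 * p + 2 * \<mu>"
    by linarith
  then show ?thesis
    by (simp add: B_def)
qed

section \<open>Distribution functions and bounds on the Kolmogorov distance\<close>

lemma cdf_normalized_completion_law:
  assumes m: "0 < mean_completion_time q D"
  shows "cdf (normalized_completion_law q D) x =
    (if x < 0 then 0 else 1 - completion_tail q D (nat \<lfloor>mean_completion_time q D * x\<rfloor>))"
proof -
  let ?P = "attempts q D" and ?m = "mean_completion_time q D"
  interpret P: prob_space ?P by (rule prob_space_attempts)
  have "cdf (normalized_completion_law q D) x = P.prob {\<omega>. real (completion_time \<omega>) \<le> ?m * x}"
    unfolding cdf_def normalized_completion_law_def
    by (subst measure_distr) (use m in \<open>auto simp: vimage_def field_simps\<close>)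
  also have "\<dots> = (if x < 0 then 0 else 1 - completion_tail q D (nat \<lfloor>?m * x\<rfloor>))"
  proof (cases "x < 0")
    case True
    then have "?m * x < 0"
      using m by (simp add: mult_pos_neg)
    then have "{\<omega>. real (completion_time \<omega>) \<le> ?m * x} = {}"
      by (auto simp: not_le intro: less_le_trans)
    then show ?thesis using True by simp
  next
    case False
    then have "0 \<le> ?m * x"
      using m by simp
    then have "{\<omega>. real (completion_time \<omega>) \<le> ?m * x} =
        UNIV - {\<omega>. nat \<lfloor>?m * x\<rfloor> < completion_time \<omega>}"
      by (auto simp: not_less le_nat_floor le_floor_iff nat_le_iff intro: order_trans) linarith+
    then show ?thesis
      using False P.prob_compl[OF sets_completion_time_gt] by (simp add: completion_tail_def)
  qed
  finally show ?thesis .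
qed

lemma prob_space_exp1_law: "prob_space exp1_law"
  unfolding exp1_law_def by (rule prob_space_exponential_density) simp

lemma cdf_exp1_law: "cdf exp1_law x = (if x < 0 then 0 else 1 - exp (- x))"
proof -
  interpret E: prob_space exp1_law
    by (rule prob_space_exp1_law)
  have D: "distributed exp1_law lborel (\<lambda>x. x) (exponential_density 1)"
    unfolding distributed_def exp1_law_def by (auto simp: distr_id2)
  have "\<P>(y in exp1_law. y \<le> x) = cdf exp1_law x"
    unfolding cdf_def by (simp add: exp1_law_def atMost_def)
  moreover have "\<P>(y in exp1_law. y \<le> x) = 1 - exp (- x)" if "0 \<le> x"
    using E.exponential_distributedD_le[OF D that] by simp
  \<comment> \<open>For negative x the value is squeezed between 0 and the value at 0.\<close>
  moreover have "cdf exp1_law x \<le> cdf exp1_law 0" if "x < 0"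
  proof -
    interpret finite_borel_measure exp1_law
      by unfold_locales (simp_all add: exp1_law_def)
    show ?thesis using that by (intro cdf_nondecreasing) simp
  qed
  moreover have "0 \<le> cdf exp1_law x"
    by (simp add: cdf_def)
  moreover have "cdf exp1_law 0 = 0"
    using E.exponential_distributedD_le[OF D order_refl] by (simp add: cdf_def exp1_law_def atMost_def)
  ultimately show ?thesis
    by force
qed

lemma cdf_le_kolmogorov_dist:
  assumes "prob_space M" "prob_space N"
  shows "\<bar>cdf M x - cdf N x\<bar> \<le> kolmogorov_dist M N"
  unfolding kolmogorov_dist_def
proof (rule cSUP_upper)
  have "\<bar>cdf M y - cdf N y\<bar> \<le> 1" for y
    using prob_space.prob_le_1[OF assms(1), of "{..y}"] prob_space.prob_le_1[OF assms(2), of "{..y}"]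
      measure_nonneg[of M "{..y}"] measure_nonneg[of N "{..y}"]
    unfolding cdf_def by linarith
  then show "bdd_above (range (\<lambda>x. \<bar>cdf M x - cdf N x\<bar>))"
    by (intro bdd_aboveI[of _ 1]) auto
qed simp

lemma prob_space_normalized_completion_law: "prob_space (normalized_completion_law q D)"
  unfolding normalized_completion_law_def
  by (rule prob_space.prob_space_distr[OF prob_space_attempts]) measurable

text \<open>The normalized time lives on the multiples of \<mu> = 1/E[T]. Between n \<mu> and (n +
  1) \<mu> its distribution function is constant and that of the exponential law varies by at most
  \<mu>; this adds one \<mu> to the bound at grid points.\<close>

lemma kolmogorov_dist_completion_le:
  assumes q: "0 < q" "q < 1" and D: "pmf D 0 = 0"
    and R: "(\<lambda>k. real k * damped q D k) sums R"
  defines "p \<equiv> pgf D (1 - q)"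
  defines "\<mu> \<equiv> q * p / (1 - p)"
  assumes \<mu>: "\<mu> \<le> 1 / 2"
  shows "kolmogorov_dist (normalized_completion_law q D) exp1_law \<le> 3 * R + 2 * p + 3 * \<mu>"
  unfolding kolmogorov_dist_def
proof (rule cSUP_least)
  fix x :: real
  have p: "0 < p" "p < 1"
    unfolding p_def using q D by (auto intro: pgf_pos pgf_less_1)
  have mu: "0 < \<mu>"
    using p q by (simp add: \<mu>_def)
  have m: "mean_completion_time q D = 1 / \<mu>"
    by (simp add: mean_completion_time_eq[OF q D] \<mu>_def p_def)
  have R0: "0 \<le> R"
    using q by (intro sums_le[OF _ sums_zero R]) (auto simp: damped_nonneg)
  show "\<bar>cdf (normalized_completion_law q D) x - cdf exp1_law x\<bar> \<le> 3 * R + 2 * p + 3 * \<mu>"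
  proof (cases "x < 0")
    case True
    then show ?thesis
      using m mu p R0 by (simp add: cdf_normalized_completion_law cdf_exp1_law)
  next
    case False
    define n where "n = nat \<lfloor>x / \<mu>\<rfloor>"
    have "0 \<le> x / \<mu>"
      using False mu by simp
    then have "real n \<le> x / \<mu>" "x / \<mu> < real n + 1"
      unfolding n_def by linarith+
    then have n: "n * \<mu> \<le> x" "x < n * \<mu> + \<mu>"
      using mu by (simp_all add: field_simps)
    have "exp (- x) \<le> exp (- \<mu>) ^ n"
      using n by (simp add: exp_of_nat_mult[symmetric])
    moreover have "exp (- \<mu>) ^ n - exp (- x) \<le> \<mu>"
    proof -
      have "1 - (x - n * \<mu>) \<le> exp (- (x - n * \<mu>))"
        using exp_ge_add_one_self[of "- (x - n * \<mu>)"] by linarith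
      then have "exp (- \<mu>) ^ n * (1 - exp (- (x - n * \<mu>))) \<le> 1 * \<mu>"
        using n mu by (intro mult_mono) (auto simp: power_le_one)
      moreover have "exp (- \<mu>) ^ n * exp (- (x - n * \<mu>)) = exp (- x)"
        by (simp add: exp_of_nat_mult[symmetric] mult_exp_exp)
      ultimately show ?thesis
        by (simp add: right_diff_distrib)
    qed
    moreover have "\<bar>completion_tail q D n - exp (- \<mu>) ^ n\<bar> \<le> 3 * R + 2 * p + 2 * \<mu>"
      using completion_tail_close_to_exp[OF q D R] \<mu> by (simp add: \<mu>_def p_def)
    moreover have "cdf (normalized_completion_law q D) x - cdf exp1_law x = exp (- x) - completion_tail q D n"
      using m mu False by (simp add: cdf_normalized_completion_law cdf_exp1_law n_def)
    ultimately show ?thesis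
      by linarith
  qed
qed simp

text \<open>Evaluate both distribution functions at x = \<mu>, where T/E[T] \<le> \<mu> means T
  \<le> 1. That event has probability c_1, and the exponential law gives [0, \<mu>] mass 1 -
  exp(-\<mu>) \<le> \<mu>.\<close>

lemma kolmogorov_dist_completion_ge:
  assumes q: "0 < q" "q < 1" and D: "pmf D 0 = 0"
  defines "p \<equiv> pgf D (1 - q)"
  shows "damped q D 1 - q * p / (1 - p) \<le> kolmogorov_dist (normalized_completion_law q D) exp1_law"
proof -
  define \<mu> where "\<mu> = q * p / (1 - p)"
  have p: "0 < p" "p < 1"
    unfolding p_def using q D by (auto intro: pgf_pos pgf_less_1)
  have mu: "0 < \<mu>"
    using p q by (simp add: \<mu>_def)
  have m: "mean_completion_time q D = 1 / \<mu>"
    by (simp add: mean_completion_time_eq[OF q D] \<mu>_def p_def)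
  have "completion_tail q D 1 = 1 - damped q D 1"
    using completion_tail_Suc[OF q D, of 0] by (simp add: completion_tail_0[OF q D] damped_def D)
  then have "damped q D 1 - \<mu> \<le> cdf (normalized_completion_law q D) \<mu> - cdf exp1_law \<mu>"
    using m mu exp_ge_add_one_self[of "- \<mu>"]
    by (simp add: cdf_normalized_completion_law cdf_exp1_law)
  also have "\<dots> \<le> kolmogorov_dist (normalized_completion_law q D) exp1_law"
    using cdf_le_kolmogorov_dist[OF prob_space_normalized_completion_law prob_space_exp1_law]
    by (rule order_trans[OF abs_ge_self])
  finally show ?thesis
    by (simp add: \<mu>_def)
qed

section \<open>Two-point base times for q = 1/2\<close>

definition two_point_pmf :: "real \<Rightarrow> nat \<Rightarrow> nat pmf" where
  "two_point_pmf \<epsilon> N = map_pmf (\<lambda>b. if b then 1 else N) (bernoulli_pmf \<epsilon>)"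

lemma set_two_point_pmf: "set_pmf (two_point_pmf \<epsilon> N) \<subseteq> {1, N}"
  by (auto simp: two_point_pmf_def)

lemma pgf_two_point_pmf:
  assumes "0 \<le> \<epsilon>" "\<epsilon> \<le> 1"
  shows "pgf (two_point_pmf \<epsilon> N) z = \<epsilon> * z + (1 - \<epsilon>) * z ^ N"
  using assms by (simp add: pgf_def two_point_pmf_def)

lemma pmf_two_point_pmf:
  assumes "0 \<le> \<epsilon>" "\<epsilon> \<le> 1" "N \<noteq> 1"
  shows "pmf (two_point_pmf \<epsilon> N) k = (if k = 1 then \<epsilon> else if k = N then 1 - \<epsilon> else 0)"
proof -
  have "{b. b} = {True}" "Collect Not = {False}"
    by auto
  then show ?thesis
    using assms by (auto simp: two_point_pmf_def pmf_map measure_pmf_single vimage_def)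
qed

lemma deriv_pgf_two_point_pmf:
  assumes "0 \<le> \<epsilon>" "\<epsilon> \<le> 1"
  shows "deriv (pgf (two_point_pmf \<epsilon> N)) z = \<epsilon> + (1 - \<epsilon>) * (real N * z ^ (N - 1))"
proof (rule DERIV_imp_deriv)
  have eq: "pgf (two_point_pmf \<epsilon> N) = (\<lambda>z. \<epsilon> * z + (1 - \<epsilon>) * z ^ N)"
    using assms by (auto simp: pgf_two_point_pmf)
  show "(pgf (two_point_pmf \<epsilon> N) has_field_derivative \<epsilon> + (1 - \<epsilon>) * (real N * z ^ (N - 1))) (at z)"
    unfolding eq by (auto intro!: derivative_eq_intros)
qed

text \<open>The constants follow from \<epsilon>/2 \<le> p \<le> 5\<epsilon>/8, R \<le>
  3\<epsilon>/4 and \<mu> \<le> 3\<epsilon>/8. The upper bound on the distance is then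
  37\<epsilon>/8 \<le> 37p/4, and the lower bound is \<epsilon>/2 - 3\<epsilon>/8 = \<epsilon>/8
  \<ge> p/5.\<close>

lemma two_point_pmf_half_estimates:
  fixes N :: nat
  defines "D \<equiv> \<lambda>\<epsilon>. two_point_pmf \<epsilon> N"
  assumes \<epsilon>: "0 < \<epsilon>" "\<epsilon> \<le> 1 / 4" and N: "2 \<le> N" "real N * (1 / 2) ^ N \<le> \<epsilon>\<^sup>2"
  defines "p \<equiv> pgf (D \<epsilon>) (1 / 2)"
  defines "d \<equiv> kolmogorov_dist (normalized_completion_law (1 / 2) (D \<epsilon>)) exp1_law"
  shows "\<epsilon> / 2 \<le> p" "p \<le> \<epsilon>" "\<bar>alpha (1 / 2) (1 / 2) (D \<epsilon>)\<bar> \<le> 2 * \<epsilon> * p"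
    "p / 5 \<le> d" "d \<le> 10 * p"
proof -
  define h where "h = (1 / 2 :: real) ^ N"
  define \<kappa> where "\<kappa> = (1 - \<epsilon>) * h"
  define R where "R = \<epsilon> / 2 + real N * \<kappa>"
  define \<mu> where "\<mu> = 1 / 2 * p / (1 - p)"
  have h: "0 < h"
    by (simp add: h_def)
  have kap: "0 \<le> \<kappa>" "\<kappa> \<le> h"
    using h \<epsilon> by (auto simp: \<kappa>_def intro: mult_left_le_one_le)
  have sq: "\<epsilon>\<^sup>2 \<le> \<epsilon> / 4"
    using \<epsilon> by (simp add: power2_eq_square)
  have Nk: "real N * \<kappa> \<le> \<epsilon>\<^sup>2"
    using N(2) mult_left_mono[OF kap(2), of "real N"] by (simp add: h_def)
  \<comment> \<open>With N \<ge> 2 the bound on N \<kappa> also controls \<kappa>, the contribution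
    of the far point to p.\<close>
  have "2 * \<kappa> \<le> real N * \<kappa>"
    using N kap by (intro mult_right_mono) auto
  then have k8: "\<kappa> \<le> \<epsilon> / 8"
    using Nk sq by linarith
  have p_eq: "p = \<epsilon> / 2 + \<kappa>"
    using \<epsilon> by (simp add: p_def D_def pgf_two_point_pmf \<kappa>_def h_def)
  show p_lower: "\<epsilon> / 2 \<le> p" and "p \<le> \<epsilon>"
    using p_eq kap k8 \<epsilon> by auto
  have p_upper: "p \<le> 5 / 8 * \<epsilon>"
    using p_eq k8 by simp
  have p: "0 < p" "p \<le> 5 / 32"
    using p_lower p_upper \<epsilon> by auto
  have pmf: "pmf (D \<epsilon>) k = (if k = 1 then \<epsilon> else if k = N then 1 - \<epsilon> else 0)" for k
    unfolding D_def using \<epsilon> N by (intro pmf_two_point_pmf) auto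
  have "(\<lambda>k. real k * damped (1 / 2) (D \<epsilon>) k) sums (\<Sum>k\<in>{1, N}. real k * damped (1 / 2) (D \<epsilon>) k)"
    by (intro sums_finite) (auto simp: damped_def pmf)
  also have "(\<Sum>k\<in>{1, N}. real k * damped (1 / 2) (D \<epsilon>) k) = R"
    using N by (simp add: damped_def pmf R_def \<kappa>_def h_def)
  finally have R: "(\<lambda>k. real k * damped (1 / 2) (D \<epsilon>) k) sums R" .
  have D0: "pmf (D \<epsilon>) 0 = 0"
    using N by (simp add: pmf)
  have R_upper: "R \<le> 3 / 4 * \<epsilon>"
    using Nk sq by (simp add: R_def)
  have mu: "\<mu> \<le> 3 / 8 * \<epsilon>"
  proof -
    have "\<mu> \<le> 1 / 2 * (5 / 8 * \<epsilon>) / (27 / 32)"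
      unfolding \<mu>_def using p p_upper by (intro frac_le) auto
    then show ?thesis
      using \<epsilon> by simp
  qed
  have "d \<le> 3 * R + 2 * p + 3 * \<mu>"
    using kolmogorov_dist_completion_le[of "1 / 2", OF _ _ D0 R] mu \<epsilon>
    by (simp add: d_def \<mu>_def p_def)
  then show "d \<le> 10 * p"
    using R_upper p_upper mu p_lower by linarith
  have "\<epsilon> / 2 - \<mu> \<le> d"
    using kolmogorov_dist_completion_ge[of "1 / 2", OF _ _ D0]
    by (simp add: d_def \<mu>_def p_def damped_def pmf)
  then show "p / 5 \<le> d"
    using p_upper mu by linarith
  have "1 / 2 * deriv (pgf (D \<epsilon>)) (1 / 2) = \<epsilon> / 2 + real N * \<kappa>"
    using \<epsilon> N by (cases N) (simp_all add: D_def deriv_pgf_two_point_pmf \<kappa>_def h_def)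
  \<comment> \<open>The contributions \<epsilon>/2 of the point 1 to p and to R cancel exactly,
    leaving only those of the far point N.\<close>
  then have "p - 1 / 2 * deriv (pgf (D \<epsilon>)) (1 / 2) = - ((real N - 1) * \<kappa>)"
    by (simp add: p_eq algebra_simps)
  then have "\<bar>alpha (1 / 2) (1 / 2) (D \<epsilon>)\<bar> = 1 / 2 * ((real N - 1) * \<kappa>) / (1 - p)"
    using p kap N by (simp add: alpha_def p_def[symmetric] abs_mult)
  also have "\<dots> \<le> 1 / 2 * \<epsilon>\<^sup>2 / (1 / 2)"
    using Nk kap p N by (intro frac_le mult_left_mono) (auto simp: left_diff_distrib)
  also have "\<dots> \<le> 2 * \<epsilon> * p"
    using p_lower \<epsilon> by (simp add: power2_eq_square)
  finally show "\<bar>alpha (1 / 2) (1 / 2) (D \<epsilon>)\<bar> \<le> 2 * \<epsilon> * p" .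
qed

section \<open>Choice of the far point and the asymptotic statements\<close>

theorem proposition4p16:
  fixes q s :: real
  assumes "q = 1 / 2" and "s = 1 / 2"
  shows "\<exists>D :: real \<Rightarrow> nat pmf.
    (\<forall>\<epsilon>>0. set_pmf (D \<epsilon>) \<subseteq> {1..}) \<and>
    ((\<lambda>\<epsilon>. pgf (D \<epsilon>) s) \<longlongrightarrow> 0) (at_right 0) \<and>
    (\<lambda>\<epsilon>. \<bar>alpha q s (D \<epsilon>)\<bar>) \<in> o[at_right 0](\<lambda>\<epsilon>. pgf (D \<epsilon>) s) \<and>
    (\<lambda>\<epsilon>. kolmogorov_dist (normalized_completion_law q (D \<epsilon>)) exp1_law)
      \<in> \<Theta>[at_right 0](\<lambda>\<epsilon>. pgf (D \<epsilon>) s)"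
proof -
  have ex: "\<exists>N\<ge>2. real N * (1 / 2) ^ N \<le> \<epsilon>\<^sup>2" if "0 < \<epsilon>" for \<epsilon> :: real
  proof -
    have "(\<lambda>N. real N * (1 / 2) ^ N) \<longlonglongrightarrow> 0"
      by (rule powser_times_n_limit_0) simp
    then have "\<forall>\<^sub>F N in sequentially. real N * (1 / 2) ^ N < \<epsilon>\<^sup>2"
      using that by (intro order_tendstoD) auto
    then have "\<forall>\<^sub>F N in sequentially. real N * (1 / 2) ^ N < \<epsilon>\<^sup>2 \<and> 2 \<le> N"
      by (intro eventually_conj eventually_ge_at_top)
    then show ?thesis
      using eventually_happens'[OF sequentially_bot] less_imp_le by blast
  qed
  define N where "N \<epsilon> = (SOME N. 2 \<le> N \<and> real N * (1 / 2) ^ N \<le> \<epsilon>\<^sup>2)" for \<epsilon> :: real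
  have N: "2 \<le> N \<epsilon>" "real (N \<epsilon>) * (1 / 2) ^ N \<epsilon> \<le> \<epsilon>\<^sup>2" if "0 < \<epsilon>" for \<epsilon>
    using someI_ex[OF ex[OF that]] by (auto simp: N_def)
  define D where "D \<epsilon> = two_point_pmf \<epsilon> (N \<epsilon>)" for \<epsilon>
  have small: "\<forall>\<^sub>F \<epsilon> in at_right 0. 0 < \<epsilon> \<and> \<epsilon> \<le> c" if "0 < c" for c :: real
    using that by (auto simp: eventually_at_right_field intro!: exI[of _ c])
  have est: "\<epsilon> / 2 \<le> pgf (D \<epsilon>) s" "pgf (D \<epsilon>) s \<le> \<epsilon>"
    "\<bar>alpha q s (D \<epsilon>)\<bar> \<le> 2 * \<epsilon> * pgf (D \<epsilon>) s"
    "pgf (D \<epsilon>) s / 5 \<le> kolmogorov_dist (normalized_completion_law q (D \<epsilon>)) exp1_law"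
    "kolmogorov_dist (normalized_completion_law q (D \<epsilon>)) exp1_law \<le> 10 * pgf (D \<epsilon>) s"
    if "0 < \<epsilon> \<and> \<epsilon> \<le> 1 / 4" for \<epsilon>
  proof -
    from that have \<epsilon>: "0 < \<epsilon>" "\<epsilon> \<le> 1 / 4"
      by auto
    show "\<epsilon> / 2 \<le> pgf (D \<epsilon>) s" "pgf (D \<epsilon>) s \<le> \<epsilon>"
      "\<bar>alpha q s (D \<epsilon>)\<bar> \<le> 2 * \<epsilon> * pgf (D \<epsilon>) s"
      "pgf (D \<epsilon>) s / 5 \<le> kolmogorov_dist (normalized_completion_law q (D \<epsilon>)) exp1_law"
      "kolmogorov_dist (normalized_completion_law q (D \<epsilon>)) exp1_law \<le> 10 * pgf (D \<epsilon>) s"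
      unfolding D_def assms
      by (rule two_point_pmf_half_estimates[OF \<epsilon> N[OF \<epsilon>(1)]])+
  qed
  \<comment> \<open>This covers every \<epsilon> > 0, beyond the range of \<open>est\<close>: the
    support lies in {1, N} whatever the weight \<epsilon>.\<close>
  have "set_pmf (D \<epsilon>) \<subseteq> {1..}" if "0 < \<epsilon>" for \<epsilon>
    using set_two_point_pmf[of \<epsilon> "N \<epsilon>"] N(1)[OF that] by (auto simp: D_def)
  moreover have "((\<lambda>\<epsilon>. pgf (D \<epsilon>) s) \<longlongrightarrow> 0) (at_right 0)"
  proof (rule tendsto_sandwich)
    show "\<forall>\<^sub>F \<epsilon> in at_right 0. 0 \<le> pgf (D \<epsilon>) s"
      using small[of "1 / 4", simplified]
    proof eventually_elim
      case (elim \<epsilon>)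
      with est(1)[of \<epsilon>] show ?case by simp
    qed
    show "\<forall>\<^sub>F \<epsilon> in at_right 0. pgf (D \<epsilon>) s \<le> \<epsilon>"
      using small[of "1 / 4", simplified]
    proof eventually_elim
      case (elim \<epsilon>)
      with est(2)[of \<epsilon>] show ?case by simp
    qed
  qed (rule tendsto_const tendsto_ident_at)+
  moreover have "(\<lambda>\<epsilon>. \<bar>alpha q s (D \<epsilon>)\<bar>) \<in> o[at_right 0](\<lambda>\<epsilon>. pgf (D \<epsilon>) s)"
  proof (rule landau_o.smallI)
    fix c :: real assume c: "0 < c"
    \<comment> \<open>The ratio of |\<alpha>| to p is at most 2 \<epsilon>, so \<epsilon> \<le> c/2
      suffices.\<close>
    have "\<forall>\<^sub>F \<epsilon> in at_right 0. 0 < \<epsilon> \<and> \<epsilon> \<le> min (1 / 4) (c / 2)"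
      using c by (intro small) simp
    then show "\<forall>\<^sub>F \<epsilon> in at_right 0. norm \<bar>alpha q s (D \<epsilon>)\<bar> \<le> c * norm (pgf (D \<epsilon>) s)"
    proof eventually_elim
      case (elim \<epsilon>)
      then have e: "0 < \<epsilon> \<and> \<epsilon> \<le> 1 / 4" and "2 * \<epsilon> \<le> c"
        by auto
      then have "2 * \<epsilon> * pgf (D \<epsilon>) s \<le> c * pgf (D \<epsilon>) s"
        using est(1)[OF e] by (intro mult_right_mono) auto
      with est(3)[OF e] have "\<bar>alpha q s (D \<epsilon>)\<bar> \<le> c * pgf (D \<epsilon>) s"
        by (rule order_trans)
      then show ?case
        using est(1)[OF e] e by simp
    qed
  qed
  moreover have "(\<lambda>\<epsilon>. kolmogorov_dist (normalized_completion_law q (D \<epsilon>)) exp1_law)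
      \<in> \<Theta>[at_right 0](\<lambda>\<epsilon>. pgf (D \<epsilon>) s)"
  proof (rule bigthetaI'[of "1 / 5" 10])
    have "\<forall>\<^sub>F \<epsilon> in at_right 0. 0 < \<epsilon> \<and> \<epsilon> \<le> (1 / 4 :: real)"
      by (intro small) simp
    then show "\<forall>\<^sub>F \<epsilon> in at_right 0. 1 / 5 * norm (pgf (D \<epsilon>) s)
          \<le> norm (kolmogorov_dist (normalized_completion_law q (D \<epsilon>)) exp1_law) \<and>
        norm (kolmogorov_dist (normalized_completion_law q (D \<epsilon>)) exp1_law)
          \<le> 10 * norm (pgf (D \<epsilon>) s)"
    proof eventually_elim
      case (elim \<epsilon>)
      then show ?case
        using est(1,4,5)[OF elim] by simp
    qed
  qed auto
  ultimately show ?thesis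
    by blast
qed

end
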